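(* Let $G$ be an abelian group, $\alpha,\beta\in G$, and let $\lambda,\pi$ be two non-empty set partitions. For a set $T$ of partitions write $s_{\alpha,\beta}(T)$ for the multiset $\{s_{\alpha,\beta}(t): t\in T\}$. (a) If $s_{\alpha,\beta}(\mathcal{T}(\lambda,l))=s_{\alpha,\beta}(\mathcal{T}(\pi,l))$ for $l=0,1$, then $s_{\alpha,\beta}(\mathcal{T}(\lambda,l,m))=s_{\alpha,\beta}(\mathcal{T}(\pi,l,m))$ for all $l,m\ge 0$. (b) If $s_{\alpha,\beta}(\mathcal{T}(\lambda,l))=s_{\beta,\alpha}(\mathcal{T}(\pi,l))$ for $l=0,1$, then $s_{\alpha,\beta}(\mathcal{T}(\lambda,l,m))=s_{\beta,\alpha}(\mathcal{T}(\pi,l,m))$ for all $l,m\ge 0$.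
   Context: A partition of $[n]=\{1,\dots,n\}$ is a collection of disjoint nonempty blocks with union $[n]$; $\Pi_n$ is the set of partitions of $[n]$ ($\Pi_0$ contains only the empty partition). A partition is represented as a graph on $[n]$ whose arcs join consecutive elements of each block: a block $\{a_1<\dots<a_j\}$ gives arcs $(a_1,a_2),\dots,(a_{j-1},a_j)$. Two arcs $(i_1,j_1),(i_2,j_2)$ form a crossing if $i_1<i_2<j_1<j_2$ and a nesting if $i_1<i_2<j_2<j_1$; $cr(\pi)$ and $ne(\pi)$ are the numbers of crossings and nestings of $\pi$. For $\alpha,\beta$ in an abelian group $G$, $s_{\alpha,\beta}(\pi)=cr(\pi)\alpha+ne(\pi)\beta$. The tree of partitions $\mathcal{T}(\Pi)$ is the rooted tree whose nodes are all partitions, with root the empty partition, where a partition $\mu$ of $[n+1]$ is a child of a partition $\lambda$ of $[n]$ iff the restriction of $\mu$ to $\{2,\dots,n+1\}$ is order-isomorphic to $\lambda$. $\mathcal{T}(\lambda)$ is the subtree rooted at $\lambda$; $\mathcal{T}(\lambda,l)$ is the set of partitions at level $l$ of $\mathcal{T}(\lambda)$ (equivalently, if $\lambda\in\Pi_n$, the partitions of $[n+l]$ whose restriction to the last $n$ elements is order-isomorphic to $\lambda$); $\mathcal{T}(\lambda,l,m)$ is the set of those with exactly $m$ blocks. *)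

theory Defs
  imports "HOL-Library.Disjoint_Sets" "HOL-Library.Multiset"
begin

definition set_partitions :: "nat \<Rightarrow> nat set set set" where
  "set_partitions n = {P. partition_on {1..n} P}"

definition arcs :: "nat set set \<Rightarrow> (nat \<times> nat) set" where
  "arcs P = {(a, b). \<exists>B\<in>P. a \<in> B \<and> b \<in> B \<and> a < b \<and> \<not> (\<exists>c\<in>B. a < c \<and> c < b)}"

definition cr :: "nat set set \<Rightarrow> nat" where
  "cr P = card {((i1, j1), (i2, j2)). (i1, j1) \<in> arcs P \<and> (i2, j2) \<in> arcs P \<and>
                  i1 < i2 \<and> i2 < j1 \<and> j1 < j2}"

definition ne :: "nat set set \<Rightarrow> nat" where
  "ne P = card {((i1, j1), (i2, j2)). (i1, j1) \<in> arcs P \<and> (i2, j2) \<in> arcs P \<and>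
                  i1 < i2 \<and> i2 < j2 \<and> j2 < j1}"

definition nat_multiple :: "nat \<Rightarrow> 'g \<Rightarrow> 'g :: ab_group_add" where
  "nat_multiple k a = (\<Sum>_<k. a)"

definition stat :: "'g \<Rightarrow> 'g \<Rightarrow> nat set set \<Rightarrow> 'g :: ab_group_add" where
  "stat \<alpha> \<beta> P = nat_multiple (cr P) \<alpha> + nat_multiple (ne P) \<beta>"

definition restriction :: "nat set set \<Rightarrow> nat set \<Rightarrow> nat set set" where
  "restriction P S = (\<lambda>B. B \<inter> S) ` P - {{}}"

definition order_isomorphic :: "nat set set \<Rightarrow> nat set set \<Rightarrow> bool" where
  "order_isomorphic P Q \<longleftrightarrow> (\<exists>f. strict_mono_on (\<Union>P) f \<and> (\<lambda>B. f ` B) ` P = Q)"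

text \<open>Pairs (parent, child).\<close>

definition child_rel :: "(nat set set \<times> nat set set) set" where
  "child_rel = {(P, Q). \<exists>n. P \<in> set_partitions n \<and> Q \<in> set_partitions (n + 1) \<and>
                  order_isomorphic (restriction Q {2..n + 1}) P}"

definition tree_level :: "nat set set \<Rightarrow> nat \<Rightarrow> nat set set set" where
  "tree_level P l = {Q. (P, Q) \<in> child_rel ^^ l}"

definition tree_level_blocks :: "nat set set \<Rightarrow> nat \<Rightarrow> nat \<Rightarrow> nat set set set" where
  "tree_level_blocks P l m = {Q \<in> tree_level P l. card Q = m}"

text \<open>
  \<^const>\<open>mset_set\<close> is the empty multiset on infinite sets; the sets of partitions it is
  applied to are finite by \<open>finite_tree_level\<close> and \<open>finite_tree_level_blocks\<close> below.
\<close>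

definition stat_mset :: "'g \<Rightarrow> 'g \<Rightarrow> nat set set set \<Rightarrow> 'g :: ab_group_add multiset" where
  "stat_mset \<alpha> \<beta> T = image_mset (stat \<alpha> \<beta>) (mset_set T)"

lemma finite_set_partitions: "finite (set_partitions n)"
proof (rule finite_subset)
  show "set_partitions n \<subseteq> Pow (Pow {1..n})"
    by (auto simp: set_partitions_def partition_on_def)
qed simp

lemma set_partitions_unique:
  assumes "P \<in> set_partitions n" "P \<in> set_partitions k"
  shows "n = k"
proof -
  have "{1..n} = {1..k}"
    using assms by (simp add: set_partitions_def partition_on_def)
  then have "card {1..n} = card {1..k}" by (rule arg_cong)
  then show ?thesis by (simp only: card_atLeastAtMost diff_Suc_1 add_0 One_nat_def)
qed

lemma tree_level_subset:
  assumes "P \<in> set_partitions n"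
  shows "tree_level P l \<subseteq> set_partitions (n + l)"
proof (induction l)
  case 0
  then show ?case using assms by (auto simp: tree_level_def)
next
  case (Suc l)
  show ?case
  proof
    fix Q assume "Q \<in> tree_level P (Suc l)"
    then obtain R where R: "R \<in> tree_level P l" "(R, Q) \<in> child_rel"
      by (auto simp: tree_level_def)
    then obtain k where k: "R \<in> set_partitions k" "Q \<in> set_partitions (k + 1)"
      by (auto simp: child_rel_def)
    have "k = n + l" using Suc R(1) k(1) set_partitions_unique by blast
    then show "Q \<in> set_partitions (n + Suc l)" using k(2) by simp
  qed
qed

lemma finite_tree_level: "P \<in> set_partitions n \<Longrightarrow> finite (tree_level P l)"
  using tree_level_subset finite_set_partitions by (metis finite_subset)

lemma finite_tree_level_blocks: "P \<in> set_partitions n \<Longrightarrow> finite (tree_level_blocks P l m)"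
  by (simp add: tree_level_blocks_def finite_tree_level)

end

theory Submission imports Defs begin

text \<open>
  List the minimal elements \<open>m\<^sub>1 < \<dots> < m\<^sub>k\<close> of the blocks of a partition and put
  \<open>a\<^sub>i = c \<alpha> + d \<beta>\<close>, where \<open>c\<close> arcs cover \<open>m\<^sub>i\<close> and \<open>d\<close> arcs end before it. Joining a new
  smallest element to the \<open>i\<close>-th block adds \<open>a\<^sub>i\<close> to the statistic and turns the sequence into
  \<open>0, a\<^sub>1 + \<alpha>, \<dots>, a\<^bsub>i-1\<^esub> + \<alpha>, a\<^bsub>i+1\<^esub> + \<beta>, \<dots>, a\<^sub>k + \<beta>\<close>; a new singleton prepends a 0. So the
  multisets in question are computed from the statistic of the root and its sequence alone, and
  the levels 0 and 1 determine this statistic and the multiset of the \<open>a\<^sub>i\<close>.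

  It remains to see that the order of the \<open>a\<^sub>i\<close> is irrelevant. As a function of a single entry
  \<open>z\<close>, the multiset at a given level has the form \<open>P + (z + Q)\<close> with \<open>P\<close> and \<open>Q\<close> independent of
  \<open>z\<close>. Hence choosing one of two adjacent entries \<open>a, b\<close> contributes in total the translates by
  \<open>a\<close> and \<open>b\<close> of \<open>P\<close> and those by \<open>a + b + \<alpha>\<close> and \<open>a + b + \<beta>\<close> of \<open>Q\<close>, which is symmetric
  in \<open>a\<close> and \<open>b\<close>. Reversing the sequence exchanges the roles of \<open>\<alpha>\<close> and \<open>\<beta>\<close>, which gives (b).
\<close>

section \<open>The recursion on sequences\<close>

text \<open>Ranges over all ways of writing the list as \<open>p @ x # q\<close>: \<open>x\<close>
  plays the chosen block, \<open>p\<close> and \<open>q\<close> the blocks with smaller and larger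
  minimum. The recursion passes the skipped entries into the first argument of
  \<open>f\<close>.\<close>

primrec split_sum :: "('a list \<Rightarrow> 'a \<Rightarrow> 'a list \<Rightarrow> 'b) \<Rightarrow> 'a list \<Rightarrow> 'b :: comm_monoid_add" where
  "split_sum f [] = 0"
| "split_sum f (x # w) = f [] x w + split_sum (\<lambda>p. f (x # p)) w"

lemma split_sum_append:
  "split_sum f (u @ w) = split_sum (\<lambda>p x q. f p x (q @ w)) u + split_sum (\<lambda>p. f (u @ p)) w"
  by (induction u arbitrary: f) (simp_all add: add.assoc)

lemma split_sum_rev: "split_sum f (rev w) = split_sum (\<lambda>p x q. f (rev q) x (rev p)) w"
proof (induction w arbitrary: f)
  case (Cons x w)
  then show ?case by (simp add: split_sum_append add.commute)
qed simp

lemma split_sum_map: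
  "split_sum f (map g w) = split_sum (\<lambda>p x q. f (map g p) (g x) (map g q)) w"
  by (induction w arbitrary: f) simp_all

lemma image_mset_split_sum:
  "image_mset h (split_sum f w) = split_sum (\<lambda>p x q. image_mset h (f p x q)) w"
  by (induction w arbitrary: f) simp_all

lemma split_sum_singleton: "split_sum (\<lambda>p x q. {#x#}) w = mset w"
  by (induction w) simp_all

text \<open>In a strictly increasing list the entries before and after \<open>x\<close> are exactly
  the smaller and the larger ones, so positions can be replaced by elements. This is what later
  connects \<open>split_sum\<close> with sums over blocks.\<close>

lemma split_sum_sorted:
  fixes w :: "'a :: linorder list"
  assumes "sorted_wrt (<) w"
  shows "split_sum f w = (\<Sum>x\<in>set w. f (filter (\<lambda>y. y < x) w) x (filter (\<lambda>y. x < y) w))"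
  using assms
proof (induction w arbitrary: f)
  case (Cons a w)
  have notin: "a \<notin> set w" using Cons.prems by auto
  have first: "filter (\<lambda>y. y < a) w = []" "filter (\<lambda>y. a < y) w = w"
    using Cons.prems by (auto simp: filter_empty_conv filter_id_conv)
  have rest: "f (filter (\<lambda>y. y < x) (a # w)) x (filter (\<lambda>y. x < y) (a # w)) =
      f (a # filter (\<lambda>y. y < x) w) x (filter (\<lambda>y. x < y) w)" if "x \<in> set w" for x
    using that Cons.prems by auto
  have "split_sum f (a # w) = f [] a w +
      (\<Sum>x\<in>set w. f (a # filter (\<lambda>y. y < x) w) x (filter (\<lambda>y. x < y) w))"
    using Cons.IH[of "\<lambda>p. f (a # p)"] Cons.prems by simp
  also have "\<dots> = (\<Sum>x\<in>set (a # w). f (filter (\<lambda>y. y < x) (a # w)) x (filter (\<lambda>y. x < y) (a # w)))"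
    using notin first sum.cong[of "set w" "set w", OF refl rest] by simp
  finally show ?case .
qed simp

text \<open>
  \<open>descend \<alpha> \<beta> l m w\<close> collects the increments of the statistic over the descendants with \<open>m\<close>
  blocks, \<open>l\<close> levels below a partition with sequence \<open>w\<close>.
\<close>

primrec descend :: "'g \<Rightarrow> 'g \<Rightarrow> nat \<Rightarrow> nat \<Rightarrow> 'g list \<Rightarrow> 'g :: ab_group_add multiset" where
  "descend \<alpha> \<beta> 0 m w = (if length w = m then {#0#} else {#})"
| "descend \<alpha> \<beta> (Suc l) m w = descend \<alpha> \<beta> l m (0 # w) +
     split_sum (\<lambda>p x q. image_mset ((+) x)
       (descend \<alpha> \<beta> l m (0 # map ((+) \<alpha>) p @ map ((+) \<beta>) q))) w"

lemma image_mset_add_add: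
  fixes a b :: "'g :: ab_group_add"
  shows "image_mset ((+) a) (image_mset ((+) b) M) = image_mset ((+) (a + b)) M"
  unfolding multiset.map_comp by (rule image_mset_cong) (simp add: add.assoc)

section \<open>Multisets depending on one entry by translation of a fixed part\<close>

definition affine_mset :: "('g :: ab_group_add \<Rightarrow> 'g multiset) \<Rightarrow> bool" where
  "affine_mset F \<longleftrightarrow> (\<exists>P Q. \<forall>z. F z = P + image_mset ((+) z) Q)"

lemma affine_mset_const: "affine_mset (\<lambda>z. P)"
  unfolding affine_mset_def by (intro exI[of _ P] exI[of _ "{#}"]) simp

lemma affine_mset_translate: "affine_mset (\<lambda>z. image_mset ((+) z) Q)"
  unfolding affine_mset_def by (intro exI[of _ "{#}"] exI[of _ Q]) simp

lemma affine_mset_add: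
  assumes "affine_mset F" "affine_mset G"
  shows "affine_mset (\<lambda>z. F z + G z)"
proof -
  obtain P Q P' Q' where "\<And>z. F z = P + image_mset ((+) z) Q"
    and "\<And>z. G z = P' + image_mset ((+) z) Q'"
    using assms unfolding affine_mset_def by metis
  then have "\<forall>z. F z + G z = (P + P') + image_mset ((+) z) (Q + Q')"
    by (simp add: add_ac)
  then show ?thesis unfolding affine_mset_def by blast
qed

lemma affine_mset_split_sum:
  assumes "\<And>p x q. affine_mset (\<lambda>z. F z p x q)"
  shows "affine_mset (\<lambda>z. split_sum (F z) w)"
  using assms
proof (induction w arbitrary: F)
  case (Cons a w)
  show ?case
    using affine_mset_add[OF Cons.prems Cons.IH[of "\<lambda>z p. F z (a # p)"]] Cons.prems by simp
qed (simp add: affine_mset_const)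

lemma affine_mset_image:
  assumes "affine_mset F"
  shows "affine_mset (\<lambda>z. image_mset ((+) c) (F z))"
proof -
  obtain P Q where "\<And>z. F z = P + image_mset ((+) z) Q"
    using assms unfolding affine_mset_def by metis
  then have "\<forall>z. image_mset ((+) c) (F z) =
      image_mset ((+) c) P + image_mset ((+) z) (image_mset ((+) c) Q)"
    by (simp add: image_mset_add_add add.commute del: image_mset.compositionality)
  then show ?thesis unfolding affine_mset_def by blast
qed

lemma affine_mset_shift:
  assumes "affine_mset F"
  shows "affine_mset (\<lambda>z. F (c + z))"
proof -
  obtain P Q where "\<And>z. F z = P + image_mset ((+) z) Q"
    using assms unfolding affine_mset_def by metis
  then have "\<forall>z. F (c + z) = P + image_mset ((+) z) (image_mset ((+) c) Q)"
    by (simp add: image_mset_add_add add.commute del: image_mset.compositionality)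
  then show ?thesis unfolding affine_mset_def by blast
qed

text \<open>An entry leaves the sequence once it is chosen, so \<open>z\<close> enters each
  increment at most once: \<open>P\<close> collects the descents that never choose \<open>z\<close>,
  and \<open>Q\<close> those that do.\<close>

lemma affine_descend: "affine_mset (\<lambda>z. descend \<alpha> \<beta> l m (u @ z # v))"
proof (induction l arbitrary: u v)
  case 0
  show ?case by (simp add: affine_mset_const)
next
  case (Suc l)
  \<comment> \<open>An entry before \<open>z\<close> is chosen, so \<open>z\<close> survives in the
    right part and is shifted by \<beta>.\<close>
  have before: "affine_mset (\<lambda>z. image_mset ((+) x)
      (descend \<alpha> \<beta> l m (0 # map ((+) \<alpha>) p @ map ((+) \<beta>) (q @ z # v))))" for p x q
    using affine_mset_image[OF affine_mset_shift[OF
        Suc[of "0 # map ((+) \<alpha>) p @ map ((+) \<beta>) q" "map ((+) \<beta>) v"]]] by simp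
  \<comment> \<open>An entry after \<open>z\<close> is chosen, so \<open>z\<close> survives in the
    left part and is shifted by \<alpha>.\<close>
  have after: "affine_mset (\<lambda>z. image_mset ((+) x)
      (descend \<alpha> \<beta> l m (0 # map ((+) \<alpha>) (u @ z # p) @ map ((+) \<beta>) q)))" for p x q
    using affine_mset_image[OF affine_mset_shift[OF
        Suc[of "0 # map ((+) \<alpha>) u" "map ((+) \<alpha>) p @ map ((+) \<beta>) q"]]] by simp
  \<comment> \<open>The summands are the new singleton and the choices within \<open>u\<close>, of
    \<open>z\<close> itself, and within \<open>v\<close>. In the third, \<open>z\<close> is used up
    and only translates a constant multiset.\<close>
  have "affine_mset (\<lambda>z. descend \<alpha> \<beta> l m ((0 # u) @ z # v) +
      (split_sum (\<lambda>p x q. image_mset ((+) x)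
        (descend \<alpha> \<beta> l m (0 # map ((+) \<alpha>) p @ map ((+) \<beta>) (q @ z # v)))) u +
      (image_mset ((+) z) (descend \<alpha> \<beta> l m (0 # map ((+) \<alpha>) u @ map ((+) \<beta>) v)) +
       split_sum (\<lambda>p x q. image_mset ((+) x)
        (descend \<alpha> \<beta> l m (0 # map ((+) \<alpha>) (u @ z # p) @ map ((+) \<beta>) q))) v)))"
    by (intro affine_mset_add affine_mset_split_sum affine_mset_translate Suc before after)
  then show ?case by (simp add: split_sum_append)
qed

section \<open>Independence of the order of the entries\<close>

lemma adjacent_swaps_imp_mset_invariant:
  assumes swap: "\<And>u a b v. h (u @ a # b # v) = h (u @ b # a # v)"
    and "mset w = mset w'"
  shows "h (u @ w) = h (u @ w')"
  using assms(2)
proof (induction w arbitrary: u w')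
  case (Cons a w)
  have "a \<in> set w'" using Cons.prems by (metis list.set_intros(1) mset_eq_setD)
  then obtain p q where w': "w' = p @ a # q" by (meson split_list)
  \<comment> \<open>The head \<open>a\<close> of \<open>w\<close> is carried to the front of
    \<open>w'\<close> by adjacent swaps. The fixed prefix \<open>u\<close> then absorbs it, and the
    induction continues with the tails.\<close>
  have move: "h (u @ p @ a # q) = h (u @ a # p @ q)" for u
  proof (induction p arbitrary: u)
    case (Cons c p)
    show ?case using Cons[of "u @ [c]"] swap[of u c a "p @ q"] by simp
  qed simp
  have "mset w = mset (p @ q)" using Cons.prems w' by simp
  then have "h ((u @ [a]) @ w) = h ((u @ [a]) @ p @ q)" by (rule Cons.IH)
  then show ?case using move[of u] w' by simp
qed simp

text \<open>Adjacent swaps suffice. If the chosen entry lies outside the swapped pair, or a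
  singleton is added, the induction hypothesis one level lower applies; only choices inside the pair
  need the affine form.\<close>

lemma descend_mset_cong:
  assumes "mset w = mset w'"
  shows "descend \<alpha> \<beta> l m w = descend \<alpha> \<beta> l m w'"
  using assms
proof (induction l arbitrary: w w')
  case 0
  then show ?case by (metis descend.simps(1) mset_eq_length)
next
  case (Suc l)
  have "descend \<alpha> \<beta> (Suc l) m (u @ a # b # v) = descend \<alpha> \<beta> (Suc l) m (u @ b # a # v)"
    for u a b v
  proof -
    \<comment> \<open>The situation after one entry of the pair has been chosen; \<open>z\<close> is
      the other entry, already shifted.\<close>
    define D where "D z = descend \<alpha> \<beta> l m (0 # map ((+) \<alpha>) u @ z # map ((+) \<beta>) v)" for z
    obtain P Q where D: "\<And>z. D z = P + image_mset ((+) z) Q"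
      using affine_descend[of \<alpha> \<beta> l m "0 # map ((+) \<alpha>) u" "map ((+) \<beta>) v"]
      unfolding affine_mset_def D_def by auto
    \<comment> \<open>When the left entry is chosen, the remaining one lies to its right and gets
      \<beta>; when the right entry is chosen, the remaining one gets \<alpha>. Expanding
      \<open>D\<close> makes both sides agree.\<close>
    have middle: "image_mset ((+) a) (D (\<beta> + b)) + image_mset ((+) b) (D (\<alpha> + a)) =
        image_mset ((+) b) (D (\<beta> + a)) + image_mset ((+) a) (D (\<alpha> + b))"
      by (simp add: D image_mset_add_add add_ac del: image_mset.compositionality)
    have left: "descend \<alpha> \<beta> l m (0 # map ((+) \<alpha>) p @ map ((+) \<beta>) (q @ a # b # v)) =
        descend \<alpha> \<beta> l m (0 # map ((+) \<alpha>) p @ map ((+) \<beta>) (q @ b # a # v))" for p q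
      by (rule Suc.IH) simp
    have right: "descend \<alpha> \<beta> l m (0 # map ((+) \<alpha>) (u @ a # b # p) @ map ((+) \<beta>) q) =
        descend \<alpha> \<beta> l m (0 # map ((+) \<alpha>) (u @ b # a # p) @ map ((+) \<beta>) q)" for p q
      by (rule Suc.IH) simp
    have zero: "descend \<alpha> \<beta> l m (0 # u @ a # b # v) = descend \<alpha> \<beta> l m (0 # u @ b # a # v)"
      by (rule Suc.IH) simp
    have expand: "descend \<alpha> \<beta> (Suc l) m (u @ c # d # v) = descend \<alpha> \<beta> l m (0 # u @ c # d # v) +
        split_sum (\<lambda>p x q. image_mset ((+) x)
          (descend \<alpha> \<beta> l m (0 # map ((+) \<alpha>) p @ map ((+) \<beta>) (q @ c # d # v)))) u +
        (image_mset ((+) c) (D (\<beta> + d)) + image_mset ((+) d) (D (\<alpha> + c))) +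
        split_sum (\<lambda>p x q. image_mset ((+) x)
          (descend \<alpha> \<beta> l m (0 # map ((+) \<alpha>) (u @ c # d # p) @ map ((+) \<beta>) q))) v" for c d
      by (simp add: split_sum_append D_def add.assoc)
    show ?thesis unfolding expand zero left right middle ..
  qed
  then show ?case
    using adjacent_swaps_imp_mset_invariant[of "descend \<alpha> \<beta> (Suc l) m" w w' "[]"] Suc.prems
    by auto
qed

text \<open>Reversing the sequence interchanges the entries before and after the chosen one, hence
  the two shifts, while \<open>descend_mset_cong\<close> makes the reversal itself
  invisible.\<close>

lemma descend_commute: "descend \<alpha> \<beta> l m w = descend \<beta> \<alpha> l m w"
proof (induction l arbitrary: w)
  case (Suc l)
  have zero: "descend \<alpha> \<beta> l m (0 # rev w) = descend \<alpha> \<beta> l m (0 # w)"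
    by (rule descend_mset_cong) simp
  have split: "descend \<alpha> \<beta> l m (0 # map ((+) \<beta>) (rev q) @ map ((+) \<alpha>) (rev p)) =
      descend \<alpha> \<beta> l m (0 # map ((+) \<alpha>) p @ map ((+) \<beta>) q)" for p q
    by (rule descend_mset_cong) simp
  have "descend \<beta> \<alpha> (Suc l) m w = descend \<beta> \<alpha> (Suc l) m (rev w)"
    by (rule descend_mset_cong) simp
  also have "\<dots> = descend \<alpha> \<beta> (Suc l) m w"
    unfolding descend.simps split_sum_rev Suc[symmetric] zero split ..
  finally show ?case ..
qed simp

section \<open>Children of a partition\<close>

text \<open>The block \<open>{}\<close>, which is never in \<open>P\<close>, encodes the child in which 1 is a singleton.\<close>

definition attach :: "nat set set \<Rightarrow> nat set \<Rightarrow> nat set set" where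
  "attach P B = insert (insert 1 (Suc ` B)) ((`) Suc ` (P - {B}))"

lemma inj_image_Suc: "inj ((`) Suc)"
  by (simp add: inj_image_eq_iff inj_def)

lemma set_partitionsD:
  assumes "P \<in> set_partitions n"
  shows "finite P" "{} \<notin> P" "disjoint P"
    and "B \<in> P \<Longrightarrow> finite B" "B \<in> P \<Longrightarrow> B \<noteq> {}" "B \<in> P \<Longrightarrow> 0 \<notin> B"
proof -
  have part: "partition_on {1..n} P" using assms by (simp add: set_partitions_def)
  show "finite P" using part by (rule finite_elements[rotated]) simp
  show "{} \<notin> P" "disjoint P" using part by (auto simp: partition_on_def)
  then show "B \<in> P \<Longrightarrow> B \<noteq> {}" by blast
  have "B \<subseteq> {1..n}" if "B \<in> P" using that part by (auto simp: partition_on_def)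
  then show "B \<in> P \<Longrightarrow> finite B" "B \<in> P \<Longrightarrow> 0 \<notin> B" by (auto intro: finite_subset)
qed

text \<open>\<open>B\<close> can be read off from the block that contains 1: no other block of
  \<open>attach P B\<close> contains 1, because the blocks of \<open>P\<close> avoid 0.\<close>

lemma inj_attach:
  assumes P: "P \<in> set_partitions n"
  shows "inj_on (attach P) (insert {} P)"
proof (rule inj_onI)
  fix B C assume BC: "B \<in> insert {} P" "C \<in> insert {} P" "attach P B = attach P C"
  then have "insert 1 (Suc ` B) \<in> attach P C" by (metis attach_def insertI1)
  moreover have "insert 1 (Suc ` B) \<noteq> Suc ` D" if "D \<in> P" for D
    using set_partitionsD(6)[OF P that] by (auto simp: set_eq_iff image_iff)
  ultimately have "insert 1 (Suc ` B) = insert 1 (Suc ` C)"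
    by (auto simp: attach_def)
  moreover have "1 \<notin> Suc ` B" "1 \<notin> Suc ` C"
    using BC set_partitionsD(6)[OF P] by auto
  ultimately have "Suc ` B = Suc ` C" by (metis insert_ident)
  then show "B = C" by (simp add: inj_image_eq_iff)
qed

text \<open>Counting from both sides: \<open>f\<close> embeds \<open>{2..x}\<close> into
  \<open>{1..f x}\<close> and \<open>{x..n + 1}\<close> into \<open>{f x..n}\<close>, which bounds
  \<open>f x\<close> from below and from above by \<open>x - 1\<close>.\<close>

lemma strict_mono_on_interval_pred:
  fixes f :: "nat \<Rightarrow> nat"
  assumes mono: "strict_mono_on {2..n + 1} f" and img: "f ` {2..n + 1} = {1..n}"
    and x: "x \<in> {2..n + 1}"
  shows "f x = x - 1"
proof -
  have inj: "inj_on f {2..n + 1}" using mono by (rule strict_mono_on_imp_inj_on)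
  have le: "f y \<le> f z" if "y \<in> {2..n + 1}" "z \<in> {2..n + 1}" "y \<le> z" for y z
    using that mono by (metis strict_mono_onD order_le_less)
  have "f ` {2..x} \<subseteq> {1..f x}"
    using le x img by fastforce
  then have "card (f ` {2..x}) \<le> f x"
    using card_mono[of "{1..f x}"] by fastforce
  moreover have "card (f ` {2..x}) = x - 1"
    using x by (subst card_image) (auto intro: inj_on_subset[OF inj])
  moreover have "f ` {x..n + 1} \<subseteq> {f x..n}"
    using le x img by fastforce
  then have "card (f ` {x..n + 1}) \<le> n + 1 - f x"
    using card_mono[of "{f x..n}"] by fastforce
  moreover have "card (f ` {x..n + 1}) = n + 2 - x"
    using x by (subst card_image) (auto intro: inj_on_subset[OF inj])
  moreover have "f x \<le> n" using img x by auto
  ultimately show ?thesis using x by auto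
qed

section \<open>Restricting a child to its upper elements\<close>

lemma Union_restriction: "\<Union> (restriction Q S) = \<Union> Q \<inter> S"
  by (auto simp: restriction_def)

text \<open>An increasing bijection between the two ground intervals is unique, so the existentially
  quantified isomorphism must be the predecessor map.\<close>

lemma order_isomorphic_restriction_iff:
  assumes P: "P \<in> set_partitions n" and Q: "Q \<in> set_partitions (n + 1)"
  shows "order_isomorphic (restriction Q {2..n + 1}) P \<longleftrightarrow>
    restriction Q {2..n + 1} = (`) Suc ` P"
proof -
  define R where "R = restriction Q {2..n + 1}"
  have UR: "\<Union> R = {2..n + 1}"
    using Q by (auto simp: R_def Union_restriction set_partitions_def partition_on_def)
  have UP: "\<Union> P = {1..n}" using P by (simp add: set_partitions_def partition_on_def)
  show ?thesis unfolding R_def[symmetric]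
  proof
    assume "order_isomorphic R P"
    then obtain f where f: "strict_mono_on {2..n + 1} f" "(`) f ` R = P"
      by (auto simp: order_isomorphic_def UR)
    have "f ` \<Union> R = \<Union> P" using f(2) by blast
    then have f_eq: "f x = x - 1" if "x \<in> {2..n + 1}" for x
      using strict_mono_on_interval_pred[OF f(1)] that UR UP by simp
    have "Suc ` f ` B = B" if "B \<in> R" for B
    proof -
      have "Suc (f x) = x" if "x \<in> B" for x
      proof -
        have "x \<in> {2..n + 1}" using that \<open>B \<in> R\<close> UR by blast
        then show ?thesis using f_eq[of x] by auto
      qed
      then show ?thesis by (force simp: image_image)
    qed
    then have "(\<lambda>B. Suc ` f ` B) ` R = R" by simp
    then show "R = (`) Suc ` P" using f(2) by (simp add: image_image flip: f(2))
  next
    assume R: "R = (`) Suc ` P"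
    have "strict_mono_on {2..n + 1} (\<lambda>x::nat. x - 1)"
      by (auto simp: strict_mono_on_def)
    moreover have "(`) (\<lambda>x::nat. x - 1) ` R = P"
      by (simp add: R image_image)
    ultimately show "order_isomorphic R P" by (auto simp: order_isomorphic_def UR)
  qed
qed

lemma Suc_image_interval: "Suc ` {1..n} = {2..n + 1}"
  by (simp add: image_Suc_atLeastAtMost numeral_2_eq_2)

lemma attach_in_set_partitions:
  assumes P: "P \<in> set_partitions n" and B: "B \<in> insert {} P"
  shows "attach P B \<in> set_partitions (n + 1)"
proof -
  have part: "\<Union> P = {1..n}" "disjoint P" "{} \<notin> P"
    using P by (auto simp: set_partitions_def partition_on_def)
  have "\<Union> (attach P B) = insert 1 (Suc ` \<Union> P)"
    using B by (auto simp: attach_def)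
  also have "\<dots> = {1..n + 1}" unfolding part Suc_image_interval by auto
  finally have "\<Union> (attach P B) = {1..n + 1}" .
  moreover have "{} \<notin> attach P B" using part by (auto simp: attach_def)
  moreover have "disjoint (attach P B)"
  proof (rule disjointI)
    have disj: "C \<inter> D = {}" if "C \<in> insert {} P" "D \<in> insert {} P" "C \<noteq> D" for C D
      using that part(2) by (auto dest: disjointD)
    have new: "insert 1 (Suc ` B) \<inter> Suc ` C = {}" if "C \<in> P - {B}" for C
      using disj[OF B, of C] that set_partitionsD(6)[OF P, of C] by auto
    have old: "Suc ` D \<inter> Suc ` C = {}" if "C \<in> P" "D \<in> P" "Suc ` D \<noteq> Suc ` C" for C D
      using disj[of C D] that by auto
    fix C D assume "C \<in> attach P B" "D \<in> attach P B" "C \<noteq> D"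
    then consider "C = insert 1 (Suc ` B)" "D \<in> (`) Suc ` (P - {B})"
      | "D = insert 1 (Suc ` B)" "C \<in> (`) Suc ` (P - {B})"
      | "C \<in> (`) Suc ` P" "D \<in> (`) Suc ` P"
      unfolding attach_def by blast
    then show "C \<inter> D = {}"
    proof cases
      case 1
      then obtain D' where "D = Suc ` D'" "D' \<in> P - {B}" by blast
      then show ?thesis using new[of D'] 1(1) by simp
    next
      case 2
      then obtain C' where "C = Suc ` C'" "C' \<in> P - {B}" by blast
      then show ?thesis using new[of C'] 2(1) by (simp add: Int_commute)
    next
      case 3
      then obtain C' D' where "C = Suc ` C'" "D = Suc ` D'" "C' \<in> P" "D' \<in> P" by blast
      then show ?thesis using old[of D' C'] \<open>C \<noteq> D\<close> by simp
    qed
  qed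
  ultimately show ?thesis by (simp add: set_partitions_def partition_on_def)
qed

lemma restriction_attach:
  assumes P: "P \<in> set_partitions n" and B: "B \<in> insert {} P"
  shows "restriction (attach P B) {2..n + 1} = (`) Suc ` P"
proof -
  have part: "\<Union> P = {1..n}" "{} \<notin> P"
    using P by (auto simp: set_partitions_def partition_on_def)
  have sub: "Suc ` C \<subseteq> {2..n + 1}" if "C \<in> insert {} P" for C
    using that part(1) Suc_image_interval[of n] by blast
  have "(\<lambda>C. C \<inter> {2..n + 1}) ` (`) Suc ` (P - {B}) = (`) Suc ` (P - {B})"
    unfolding image_image using sub by (intro image_cong) auto
  moreover have "insert 1 (Suc ` B) \<inter> {2..n + 1} = Suc ` B" using sub[OF B] by auto
  ultimately have "restriction (attach P B) {2..n + 1} = insert (Suc ` B) ((`) Suc ` (P - {B})) - {{}}"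
    by (simp add: restriction_def attach_def)
  \<comment> \<open>For \<open>B = {}\<close> the inserted set is empty and is discarded again by
    \<open>- {{}}\<close>.\<close>
  also have "\<dots> = (`) Suc ` P" using part(2) B by auto
  finally show ?thesis .
qed

text \<open>Restricting \<open>Q\<close> only affects the block \<open>X\<close> that contains 1;
  what remains of \<open>X\<close> is the shift of the block to which 1 was joined.\<close>

lemma restriction_imp_attach:
  assumes P: "P \<in> set_partitions n" and Q: "Q \<in> set_partitions (n + 1)"
    and R: "restriction Q {2..n + 1} = (`) Suc ` P"
  shows "\<exists>B\<in>insert {} P. Q = attach P B"
proof -
  have part: "\<Union> Q = {1..n + 1}" "disjoint Q" "{} \<notin> Q" "{} \<notin> P"
    using P Q by (auto simp: set_partitions_def partition_on_def)
  obtain X where X: "X \<in> Q" "1 \<in> X" using part(1) by (metis UnionE atLeastAtMost_iff le_add2 order_refl)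
  have Xsub: "X \<subseteq> {1..n + 1}" using X part(1) by blast
  define Y where "Y = X \<inter> {2..n + 1}"
  have interval: "{1..n + 1} = insert 1 {2..n + 1}" by auto
  then have XY: "X = insert 1 Y" using X Xsub unfolding Y_def by blast
  have other: "D \<inter> {2..n + 1} = D" "D \<inter> Y = {}" if "D \<in> Q - {X}" for D
  proof -
    have "D \<inter> X = {}" using that X part(2) by (auto dest: disjointD)
    moreover have "D \<subseteq> insert 1 {2..n + 1}" using that part(1) interval by blast
    ultimately show "D \<inter> {2..n + 1} = D" "D \<inter> Y = {}" using XY by blast+
  qed
  have "(\<lambda>D. D \<inter> {2..n + 1}) ` (Q - {X}) = Q - {X}" using other(1) by simp
  moreover have "Q = insert X (Q - {X})" using X by auto
  ultimately have res: "restriction Q {2..n + 1} = insert Y (Q - {X}) - {{}}"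
    unfolding restriction_def by (metis Y_def image_insert)
  \<comment> \<open>If 1 is a singleton of \<open>Q\<close>, then \<open>Y\<close> is empty and
    leaves no trace in the restriction; this is the case \<open>B = {}\<close>.\<close>
  have "Y \<in> insert {} ((`) Suc ` P)" using res R by auto
  then obtain B where B: "B \<in> insert {} P" "Y = Suc ` B" by auto
  \<comment> \<open>Otherwise \<open>Y\<close> would be disjoint from itself, hence an empty block
    of \<open>Q\<close>. So removing \<open>Y\<close> from the restriction recovers precisely the
    blocks other than \<open>X\<close>.\<close>
  have "Y \<notin> Q - {X}" using other(2)[of Y] part(3) by auto
  then have "Q - {X} = insert Y (Q - {X}) - {{}} - {Y}" using part(3) by blast
  then have "Q - {X} = (`) Suc ` P - {Y}" unfolding res[symmetric] R .
  also have "\<dots> = (`) Suc ` (P - {B})"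
    unfolding B(2) by (auto simp: inj_image_eq_iff)
  finally have "Q = attach P B" unfolding attach_def using X XY B(2) by blast
  then show ?thesis using B(1) by blast
qed

section \<open>Explicit children, and disjointness of their subtrees\<close>

lemma child_rel_iff:
  assumes P: "P \<in> set_partitions n"
  shows "(P, Q) \<in> child_rel \<longleftrightarrow> Q \<in> attach P ` insert {} P"
proof
  assume "(P, Q) \<in> child_rel"
  then have "Q \<in> set_partitions (n + 1)" "order_isomorphic (restriction Q {2..n + 1}) P"
    using set_partitions_unique[OF P] by (auto simp: child_rel_def)
  then show "Q \<in> attach P ` insert {} P"
    using restriction_imp_attach[OF P] order_isomorphic_restriction_iff[OF P] by blast
next
  assume "Q \<in> attach P ` insert {} P"
  then have "Q \<in> set_partitions (n + 1)" "restriction Q {2..n + 1} = (`) Suc ` P"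
    using attach_in_set_partitions[OF P] restriction_attach[OF P] by blast+
  then show "(P, Q) \<in> child_rel"
    using P order_isomorphic_restriction_iff[OF P] by (auto simp: child_rel_def)
qed

lemma child_rel_parent_unique:
  assumes "(P, Q) \<in> child_rel" "(P', Q) \<in> child_rel"
  shows "P = P'"
proof -
  obtain n where n: "P \<in> set_partitions n" "Q \<in> set_partitions (n + 1)"
    "order_isomorphic (restriction Q {2..n + 1}) P"
    using assms(1) by (auto simp: child_rel_def)
  obtain n' where n': "P' \<in> set_partitions n'" "Q \<in> set_partitions (n' + 1)"
    "order_isomorphic (restriction Q {2..n' + 1}) P'"
    using assms(2) by (auto simp: child_rel_def)
  have "n' = n" using set_partitions_unique[OF n(2) n'(2)] by simp
  then have "(`) Suc ` P = (`) Suc ` P'"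
    using n n' order_isomorphic_restriction_iff by metis
  then show ?thesis by (simp add: inj_image_eq_iff[OF inj_image_Suc])
qed

text \<open>Ensures that different children of a partition have disjoint sets of descendants at each
  level, so that their multisets add up.\<close>

lemma child_rel_ancestor_unique:
  assumes "(P, Q) \<in> child_rel ^^ l" "(P', Q) \<in> child_rel ^^ l"
  shows "P = P'"
  using assms
proof (induction l arbitrary: Q)
  case (Suc l)
  then show ?case by (metis child_rel_parent_unique relpow_Suc_E)
qed simp

text \<open>The first generation is split off rather than the last, in agreement with the recursion
  of \<open>descend\<close>.\<close>

lemma tree_level_blocks_Suc:
  assumes "P \<in> set_partitions n"
  shows "tree_level_blocks P (Suc l) m =
    (\<Union>B\<in>insert {} P. tree_level_blocks (attach P B) l m)"
proof -
  have "(P, Q) \<in> child_rel ^^ Suc l \<longleftrightarrow> (\<exists>B\<in>insert {} P. (attach P B, Q) \<in> child_rel ^^ l)" for Q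
  proof
    assume "(P, Q) \<in> child_rel ^^ Suc l"
    then show "\<exists>B\<in>insert {} P. (attach P B, Q) \<in> child_rel ^^ l"
      using child_rel_iff[OF assms] by (metis imageE relpow_Suc_D2)
  next
    assume "\<exists>B\<in>insert {} P. (attach P B, Q) \<in> child_rel ^^ l"
    then show "(P, Q) \<in> child_rel ^^ Suc l"
      using child_rel_iff[OF assms] by (metis imageI relpow_Suc_I2)
  qed
  then show ?thesis by (auto simp: tree_level_blocks_def tree_level_def simp del: relpow.simps)
qed

section \<open>Arcs and block minima of a child\<close>

text \<open>Phrased for an arbitrary set of arcs, unlike \<open>cr\<close>, so that the effect of
  one additional arc can be computed.\<close>

definition crossings :: "(nat \<times> nat) set \<Rightarrow> ((nat \<times> nat) \<times> (nat \<times> nat)) set" where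
  "crossings A = {((i1, j1), (i2, j2)). (i1, j1) \<in> A \<and> (i2, j2) \<in> A \<and>
                  i1 < i2 \<and> i2 < j1 \<and> j1 < j2}"

definition nestings :: "(nat \<times> nat) set \<Rightarrow> ((nat \<times> nat) \<times> (nat \<times> nat)) set" where
  "nestings A = {((i1, j1), (i2, j2)). (i1, j1) \<in> A \<and> (i2, j2) \<in> A \<and>
                  i1 < i2 \<and> i2 < j2 \<and> j2 < j1}"

text \<open>These are the arcs crossed by a new arc that starts to the left of everything and ends
  at \<open>m\<close>.\<close>

definition covering :: "(nat \<times> nat) set \<Rightarrow> nat \<Rightarrow> (nat \<times> nat) set" where
  "covering A m = {(i, j) \<in> A. i < m \<and> m < j}"

text \<open>These are the arcs nested below such a new arc.\<close>

definition preceding :: "(nat \<times> nat) set \<Rightarrow> nat \<Rightarrow> (nat \<times> nat) set" where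
  "preceding A m = {(i, j) \<in> A. j < m}"

definition shift_arcs :: "(nat \<times> nat) set \<Rightarrow> (nat \<times> nat) set" where
  "shift_arcs A = map_prod Suc Suc ` A"

lemma in_shift_arcs_iff:
  "(i, j) \<in> shift_arcs A \<longleftrightarrow> (\<exists>i' j'. i = Suc i' \<and> j = Suc j' \<and> (i', j') \<in> A)"
  by (force simp: shift_arcs_def)

lemma inj_map_prod_Suc: "inj_on (map_prod Suc Suc) S"
  by (auto simp: inj_on_def)

lemma card_covering_shift: "card (covering (shift_arcs A) (Suc m)) = card (covering A m)"
proof -
  have "covering (shift_arcs A) (Suc m) = map_prod Suc Suc ` covering A m"
    by (fastforce simp: covering_def in_shift_arcs_iff image_iff)
  then show ?thesis by (simp add: card_image inj_map_prod_Suc)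
qed

lemma card_preceding_shift: "card (preceding (shift_arcs A) (Suc m)) = card (preceding A m)"
proof -
  have "preceding (shift_arcs A) (Suc m) = map_prod Suc Suc ` preceding A m"
    by (fastforce simp: preceding_def in_shift_arcs_iff image_iff)
  then show ?thesis by (simp add: card_image inj_map_prod_Suc)
qed

lemma card_crossings_shift: "card (crossings (shift_arcs A)) = card (crossings A)"
proof -
  have "crossings (shift_arcs A) = map_prod (map_prod Suc Suc) (map_prod Suc Suc) ` crossings A"
    by (fastforce simp: crossings_def in_shift_arcs_iff image_iff)
  moreover have "inj_on (map_prod (map_prod Suc Suc) (map_prod Suc Suc)) S" for S
    by (auto simp: inj_on_def)
  ultimately show ?thesis by (simp add: card_image)
qed

lemma card_nestings_shift: "card (nestings (shift_arcs A)) = card (nestings A)"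
proof -
  have "nestings (shift_arcs A) = map_prod (map_prod Suc Suc) (map_prod Suc Suc) ` nestings A"
    by (fastforce simp: nestings_def in_shift_arcs_iff image_iff)
  moreover have "inj_on (map_prod (map_prod Suc Suc) (map_prod Suc Suc)) S" for S
    by (auto simp: inj_on_def)
  ultimately show ?thesis by (simp add: card_image)
qed

lemma finite_crossings: "finite A \<Longrightarrow> finite (crossings A)"
  by (rule finite_subset[of _ "A \<times> A"]) (auto simp: crossings_def)

lemma finite_nestings: "finite A \<Longrightarrow> finite (nestings A)"
  by (rule finite_subset[of _ "A \<times> A"]) (auto simp: nestings_def)

lemma finite_covering: "finite A \<Longrightarrow> finite (covering A m)"
  by (rule finite_subset[of _ A]) (auto simp: covering_def)

lemma finite_preceding: "finite A \<Longrightarrow> finite (preceding A m)"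
  by (rule finite_subset[of _ A]) (auto simp: preceding_def)

lemma finite_shift_arcs: "finite A \<Longrightarrow> finite (shift_arcs A)"
  by (simp add: shift_arcs_def)

text \<open>The new arc starts before all others, so it can only be the first arc of a crossing; its
  partners are the arcs covering its endpoint.\<close>

lemma card_crossings_insert:
  assumes "finite A" and pos: "\<And>i j. (i, j) \<in> A \<Longrightarrow> 0 < i"
  shows "card (crossings (insert (1, Suc m) (shift_arcs A))) = card (crossings A) + card (covering A m)"
proof -
  have "crossings (insert (1, Suc m) (shift_arcs A)) =
      crossings (shift_arcs A) \<union> Pair (1, Suc m) ` covering (shift_arcs A) (Suc m)"
    by (auto simp: crossings_def covering_def in_shift_arcs_iff dest: pos)
  moreover have "crossings (shift_arcs A) \<inter> Pair (1, Suc m) ` covering (shift_arcs A) (Suc m) = {}"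
    by (auto simp: crossings_def in_shift_arcs_iff dest: pos)
  moreover have "card (Pair (1, Suc m) ` covering (shift_arcs A) (Suc m)) = card (covering A m)"
    by (simp add: card_image inj_on_def card_covering_shift)
  ultimately show ?thesis
    using assms(1)
    by (simp add: card_Un_disjoint finite_crossings finite_covering finite_shift_arcs card_crossings_shift
        del: One_nat_def)
qed

text \<open>The new arc can only be the outer arc of a nesting; its partners are the arcs ending
  before its endpoint.\<close>

lemma card_nestings_insert:
  assumes "finite A" and pos: "\<And>i j. (i, j) \<in> A \<Longrightarrow> 0 < i \<and> i < j"
  shows "card (nestings (insert (1, Suc m) (shift_arcs A))) = card (nestings A) + card (preceding A m)"
proof -
  have "nestings (insert (1, Suc m) (shift_arcs A)) =
      nestings (shift_arcs A) \<union> Pair (1, Suc m) ` preceding (shift_arcs A) (Suc m)"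
    by (auto simp: nestings_def preceding_def in_shift_arcs_iff dest: pos)
  moreover have "nestings (shift_arcs A) \<inter> Pair (1, Suc m) ` preceding (shift_arcs A) (Suc m) = {}"
    by (auto simp: nestings_def in_shift_arcs_iff dest: pos)
  moreover have "card (Pair (1, Suc m) ` preceding (shift_arcs A) (Suc m)) = card (preceding A m)"
    by (simp add: card_image inj_on_def card_preceding_shift)
  ultimately show ?thesis
    using assms(1)
    by (simp add: card_Un_disjoint finite_nestings finite_preceding finite_shift_arcs card_nestings_shift
        del: One_nat_def)
qed

section \<open>The statistic and its increments\<close>

lemma nat_multiple_0 [simp]: "nat_multiple 0 a = 0"
  by (simp add: nat_multiple_def)

lemma nat_multiple_Suc [simp]: "nat_multiple (Suc k) a = a + nat_multiple k a"
  by (simp add: nat_multiple_def add.commute)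

lemma nat_multiple_add: "nat_multiple (k + l) a = nat_multiple k a + nat_multiple l a"
  by (induction k) (simp_all add: add.assoc)

lemma stat_altdef:
  "stat \<alpha> \<beta> P = nat_multiple (card (crossings (arcs P))) \<alpha> + nat_multiple (card (nestings (arcs P))) \<beta>"
  by (simp add: stat_def cr_def ne_def crossings_def nestings_def)

text \<open>For the arcs \<open>A\<close> of a partition, this is the increment of the statistic
  when a new smallest element is joined to the block with minimum \<open>m\<close>.\<close>

definition weight :: "'g \<Rightarrow> 'g \<Rightarrow> (nat \<times> nat) set \<Rightarrow> nat \<Rightarrow> 'g :: ab_group_add" where
  "weight \<alpha> \<beta> A m = nat_multiple (card (covering A m)) \<alpha> + nat_multiple (card (preceding A m)) \<beta>"

lemma weight_shift: "weight \<alpha> \<beta> (shift_arcs A) (Suc m) = weight \<alpha> \<beta> A m"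
  by (simp add: weight_def card_covering_shift card_preceding_shift)

text \<open>No arc starts or ends before 1. This gives the leading 0 in the sequence of every
  child.\<close>

lemma weight_at_1:
  assumes "\<And>i j. (i, j) \<in> A \<Longrightarrow> 0 < i \<and> i < j"
  shows "weight \<alpha> \<beta> A 1 = 0"
proof -
  have "covering A 1 = {}" "preceding A 1 = {}"
    using assms by (fastforce simp: covering_def preceding_def)+
  then show ?thesis by (simp add: weight_def)
qed

lemma one_notin_shift_arcs:
  assumes "\<And>i j. (i, j) \<in> A \<Longrightarrow> 0 < i"
  shows "(1, j) \<notin> shift_arcs A"
  using assms by (auto simp: in_shift_arcs_iff)

text \<open>The new arc covers the shifted point, which adds one \<alpha>.\<close>

lemma weight_insert_less:
  assumes "finite A" and pos: "\<And>i j. (i, j) \<in> A \<Longrightarrow> 0 < i" and "0 < x" "x < m"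
  shows "weight \<alpha> \<beta> (insert (1, Suc m) (shift_arcs A)) (Suc x) = \<alpha> + weight \<alpha> \<beta> A x"
proof -
  have "covering (insert (1, Suc m) (shift_arcs A)) (Suc x) =
      insert (1, Suc m) (covering (shift_arcs A) (Suc x))"
    and "preceding (insert (1, Suc m) (shift_arcs A)) (Suc x) = preceding (shift_arcs A) (Suc x)"
    using assms by (auto simp: covering_def preceding_def)
  moreover have "(1, Suc m) \<notin> covering (shift_arcs A) (Suc x)"
    using one_notin_shift_arcs[OF pos] by (auto simp: covering_def)
  ultimately show ?thesis
    using assms(1) by (simp add: weight_def card_covering_shift card_preceding_shift
        finite_covering finite_shift_arcs add.assoc)
qed

text \<open>The new arc ends before the shifted point, which adds one \<beta>.\<close>

lemma weight_insert_greater: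
  assumes "finite A" and pos: "\<And>i j. (i, j) \<in> A \<Longrightarrow> 0 < i" and "m < x"
  shows "weight \<alpha> \<beta> (insert (1, Suc m) (shift_arcs A)) (Suc x) = \<beta> + weight \<alpha> \<beta> A x"
proof -
  have "preceding (insert (1, Suc m) (shift_arcs A)) (Suc x) =
      insert (1, Suc m) (preceding (shift_arcs A) (Suc x))"
    and "covering (insert (1, Suc m) (shift_arcs A)) (Suc x) = covering (shift_arcs A) (Suc x)"
    using assms by (auto simp: covering_def preceding_def)
  moreover have "(1, Suc m) \<notin> preceding (shift_arcs A) (Suc x)"
    using one_notin_shift_arcs[OF pos] by (auto simp: preceding_def)
  ultimately show ?thesis
    using assms(1) by (simp add: weight_def card_covering_shift card_preceding_shift
        finite_preceding finite_shift_arcs add_ac)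
qed

text \<open>Separates the contribution of each block, since attaching 1 enlarges at most one of
  them.\<close>

definition block_arcs :: "nat set \<Rightarrow> (nat \<times> nat) set" where
  "block_arcs B = {(a, b). a \<in> B \<and> b \<in> B \<and> a < b \<and> \<not> (\<exists>c\<in>B. a < c \<and> c < b)}"

lemma arcs_eq_UN_block_arcs: "arcs P = \<Union> (block_arcs ` P)"
  by (auto simp: arcs_def block_arcs_def)

lemma block_arcs_Suc_image: "block_arcs (Suc ` B) = shift_arcs (block_arcs B)"
  by (auto simp: block_arcs_def in_shift_arcs_iff)

text \<open>As 1 lies below all shifted elements, its successor in the enlarged block is the shifted
  minimum, and no other consecutive pair changes.\<close>

lemma block_arcs_insert_1:
  assumes "finite B" "B \<noteq> {}" "0 \<notin> B"
  shows "block_arcs (insert 1 (Suc ` B)) = insert (1, Suc (Min B)) (shift_arcs (block_arcs B))"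
proof -
  have min: "Min B \<in> B" "\<And>x. x \<in> B \<Longrightarrow> Min B \<le> x" "0 < Min B"
    using assms by (auto intro: gr0I simp: Min_gr_iff)
  show ?thesis
  proof (intro set_eqI iffI; clarify)
    fix a b assume ab: "(a, b) \<in> block_arcs (insert 1 (Suc ` B))"
      "(a, b) \<notin> shift_arcs (block_arcs B)"
    have "a = 1"
    proof (rule ccontr)
      assume "a \<noteq> 1"
      then have "(a, b) \<in> block_arcs (Suc ` B)"
        using ab(1) by (auto simp: block_arcs_def)
      then show False using ab(2) by (simp add: block_arcs_Suc_image)
    qed
    moreover obtain b' where "b' \<in> B" "b = Suc b'"
      using ab(1) \<open>a = 1\<close> by (auto simp: block_arcs_def)
    \<comment> \<open>Otherwise \<open>Suc (Min B)\<close> would lie strictly between the ends of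
      the arc.\<close>
    moreover have "\<not> Min B < b'"
      using ab(1) min calculation by (auto simp: block_arcs_def)
    ultimately show "a = 1 \<and> b = Suc (Min B)" using min(2)[of b'] by simp
  next
    fix a b assume *: "(a, b) \<in> insert (1, Suc (Min B)) (shift_arcs (block_arcs B))"
    show "(a, b) \<in> block_arcs (insert 1 (Suc ` B))"
    proof (cases "(a, b) = (1, Suc (Min B))")
      case True
      then show ?thesis using min by (fastforce simp: block_arcs_def)
    next
      case False
      then have "(a, b) \<in> block_arcs (Suc ` B)" using * by (auto simp: block_arcs_Suc_image)
      then show ?thesis by (auto simp: block_arcs_def)
    qed
  qed
qed

lemma shift_arcs_UN: "shift_arcs (\<Union> (f ` P)) = (\<Union>B\<in>P. shift_arcs (f B))"
  by (auto simp: shift_arcs_def)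

lemma arcs_attach_empty:
  assumes "{} \<notin> P"
  shows "arcs (attach P {}) = shift_arcs (arcs P)"
proof -
  have "block_arcs {1} = {}" by (auto simp: block_arcs_def)
  then show ?thesis
    using assms by (simp add: attach_def arcs_eq_UN_block_arcs shift_arcs_UN block_arcs_Suc_image)
qed

lemma arcs_attach:
  assumes "B \<in> P" "finite B" "B \<noteq> {}" "0 \<notin> B"
  shows "arcs (attach P B) = insert (1, Suc (Min B)) (shift_arcs (arcs P))"
proof -
  have "arcs (attach P B) = insert (1, Suc (Min B)) (shift_arcs (block_arcs B)) \<union>
      (\<Union>C\<in>P - {B}. shift_arcs (block_arcs C))"
    by (simp add: attach_def arcs_eq_UN_block_arcs block_arcs_Suc_image
        block_arcs_insert_1[OF assms(2-4)] del: One_nat_def)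
  also have "\<dots> = insert (1, Suc (Min B)) (shift_arcs (arcs P))"
    using assms(1) by (auto simp: arcs_eq_UN_block_arcs shift_arcs_UN)
  finally show ?thesis .
qed

lemma arcs_pos:
  assumes "P \<in> set_partitions n" "(i, j) \<in> arcs P"
  shows "0 < i \<and> i < j"
  using assms(2) set_partitionsD(6)[OF assms(1)] by (auto simp: arcs_def intro!: gr0I)

lemma finite_arcs:
  assumes "P \<in> set_partitions n"
  shows "finite (arcs P)"
proof (rule finite_subset)
  show "arcs P \<subseteq> \<Union> P \<times> \<Union> P" by (auto simp: arcs_def)
  show "finite (\<Union> P \<times> \<Union> P)" using assms by (auto simp: set_partitions_def partition_on_def)
qed

section \<open>Block minima of a child\<close>

definition minima :: "nat set set \<Rightarrow> nat list" where
  "minima P = sorted_list_of_set (Min ` P)"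

lemma set_minima:
  assumes "P \<in> set_partitions n"
  shows "set (minima P) = Min ` P"
  using set_partitionsD(1)[OF assms] by (simp add: minima_def)

lemma sorted_minima: "sorted_wrt (<) (minima P)"
  by (simp add: minima_def)

lemma minima_pos:
  assumes "P \<in> set_partitions n" "x \<in> set (minima P)"
  shows "0 < x"
  using assms set_partitionsD(4-6)[OF assms(1)] Min_in by (fastforce simp: set_minima intro!: gr0I)

lemma inj_on_Min:
  assumes "P \<in> set_partitions n"
  shows "inj_on Min P"
proof (rule inj_onI, rule ccontr)
  fix B C assume *: "B \<in> P" "C \<in> P" "Min B = Min C" "B \<noteq> C"
  then have "B \<inter> C = {}" using set_partitionsD(3)[OF assms] by (auto dest: disjointD)
  moreover have "Min B \<in> B" "Min C \<in> C" using *(1,2) set_partitionsD(4,5)[OF assms] by simp_all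
  ultimately show False using *(3) by auto
qed

lemma length_minima:
  assumes "P \<in> set_partitions n"
  shows "length (minima P) = card P"
  using inj_on_Min[OF assms] by (simp add: minima_def card_image)

lemma minima_eqI:
  assumes "P \<in> set_partitions n" "sorted_wrt (<) xs" "set xs = Min ` P"
  shows "minima P = xs"
  using assms by (metis minima_def sorted_list_of_set.idem_if_sorted_distinct strict_sorted_iff)

lemma Min_Suc_image: "finite B \<Longrightarrow> B \<noteq> {} \<Longrightarrow> Min (Suc ` B) = Suc (Min B)"
  by (simp add: mono_Min_commute[symmetric] mono_Suc)

lemma Min_image_attach:
  assumes P: "P \<in> set_partitions n" and B: "B \<in> insert {} P"
  shows "Min ` attach P B = insert 1 (Suc ` Min ` (P - {B}))"
proof -
  have "finite B" using B set_partitionsD(4)[OF P] by auto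
  then have "Min (insert 1 (Suc ` B)) = 1"
    by (intro Min_eqI) auto
  moreover have "Min ` (`) Suc ` (P - {B}) = Suc ` Min ` (P - {B})"
    unfolding image_image using set_partitionsD(4,5)[OF P] by (intro image_cong) (auto simp: Min_Suc_image)
  ultimately show ?thesis by (simp add: attach_def)
qed

lemma minima_attach_empty:
  assumes P: "P \<in> set_partitions n"
  shows "minima (attach P {}) = 1 # map Suc (minima P)"
proof (rule minima_eqI)
  show "attach P {} \<in> set_partitions (n + 1)" by (rule attach_in_set_partitions[OF P]) simp
  show "sorted_wrt (<) (1 # map Suc (minima P))"
    using sorted_minima[of P] minima_pos[OF P] by (auto simp: sorted_wrt_map)
  show "set (1 # map Suc (minima P)) = Min ` attach P {}"
    using Min_image_attach[OF P, of "{}"] set_partitionsD(2)[OF P] by (simp add: set_minima[OF P])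
qed

text \<open>The enlarged block now has minimum 1, so \<open>Min B\<close> disappears. The remaining
  minima are kept in two groups because their weights are shifted differently.\<close>

lemma minima_attach:
  assumes P: "P \<in> set_partitions n" and B: "B \<in> P"
  shows "minima (attach P B) = 1 # map Suc (filter (\<lambda>y. y < Min B) (minima P)) @
    map Suc (filter (\<lambda>y. Min B < y) (minima P))"
proof (rule minima_eqI)
  show "attach P B \<in> set_partitions (n + 1)" using B by (intro attach_in_set_partitions[OF P]) simp
  show "sorted_wrt (<) (1 # map Suc (filter (\<lambda>y. y < Min B) (minima P)) @
      map Suc (filter (\<lambda>y. Min B < y) (minima P)))"
    using sorted_minima[of P] minima_pos[OF P]
    by (auto simp: sorted_wrt_map sorted_wrt_append sorted_wrt_filter)
  have "Min ` (P - {B}) = Min ` P - {Min B}"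
    using inj_on_image_set_diff[OF inj_on_Min[OF P], of P "{B}"] B by simp
  moreover have "{y \<in> Min ` P. y < Min B} \<union> {y \<in> Min ` P. Min B < y} = Min ` P - {Min B}"
    by auto
  ultimately show "set (1 # map Suc (filter (\<lambda>y. y < Min B) (minima P)) @
      map Suc (filter (\<lambda>y. Min B < y) (minima P))) = Min ` attach P B"
    using Min_image_attach[OF P, of B] B by (simp add: set_minima[OF P] flip: image_Un)
qed

section \<open>The sequence of the \<open>a\<^sub>i\<close> and its change under attaching 1\<close>

definition weights :: "'g \<Rightarrow> 'g \<Rightarrow> nat set set \<Rightarrow> 'g :: ab_group_add list" where
  "weights \<alpha> \<beta> P = map (weight \<alpha> \<beta> (arcs P)) (minima P)"

lemma weights_attach_empty:
  assumes P: "P \<in> set_partitions n"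
  shows "weights \<alpha> \<beta> (attach P {}) = 0 # weights \<alpha> \<beta> P"
proof -
  have "attach P {} \<in> set_partitions (n + 1)" by (rule attach_in_set_partitions[OF P]) simp
  then have "weight \<alpha> \<beta> (arcs (attach P {})) 1 = 0" by (intro weight_at_1 arcs_pos)
  then show ?thesis
    using arcs_attach_empty[OF set_partitionsD(2)[OF P]]
    by (simp add: weights_def minima_attach_empty[OF P] weight_shift)
qed

text \<open>The new arc covers the minima below \<open>Min B\<close> and ends before those above it,
  which yields the sequence in the recursion of \<open>descend\<close>.\<close>

lemma weights_attach:
  assumes P: "P \<in> set_partitions n" and B: "B \<in> P"
  shows "weights \<alpha> \<beta> (attach P B) =
    0 # map (\<lambda>x. \<alpha> + weight \<alpha> \<beta> (arcs P) x) (filter (\<lambda>y. y < Min B) (minima P)) @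
    map (\<lambda>x. \<beta> + weight \<alpha> \<beta> (arcs P) x) (filter (\<lambda>y. Min B < y) (minima P))"
proof -
  have "attach P B \<in> set_partitions (n + 1)" using B by (intro attach_in_set_partitions[OF P]) simp
  then have one: "weight \<alpha> \<beta> (arcs (attach P B)) 1 = 0" by (intro weight_at_1 arcs_pos)
  have arcs: "arcs (attach P B) = insert (1, Suc (Min B)) (shift_arcs (arcs P))"
    using B set_partitionsD(4-6)[OF P B] by (rule arcs_attach)
  have pos: "0 < i" if "(i, j) \<in> arcs P" for i j using arcs_pos[OF P that] by simp
  have less: "weight \<alpha> \<beta> (arcs (attach P B)) (Suc x) = \<alpha> + weight \<alpha> \<beta> (arcs P) x"
    if "x \<in> set (minima P)" "x < Min B" for x
    unfolding arcs using finite_arcs[OF P] pos minima_pos[OF P that(1)] that(2)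
    by (rule weight_insert_less)
  have greater: "weight \<alpha> \<beta> (arcs (attach P B)) (Suc x) = \<beta> + weight \<alpha> \<beta> (arcs P) x"
    if "Min B < x" for x
    unfolding arcs using finite_arcs[OF P] pos that by (rule weight_insert_greater)
  show ?thesis
    unfolding weights_def minima_attach[OF P B] using one less greater by simp
qed

lemma stat_attach_empty:
  assumes P: "P \<in> set_partitions n"
  shows "stat \<alpha> \<beta> (attach P {}) = stat \<alpha> \<beta> P"
  by (simp add: stat_altdef arcs_attach_empty[OF set_partitionsD(2)[OF P]]
      card_crossings_shift card_nestings_shift)

lemma stat_attach:
  assumes P: "P \<in> set_partitions n" and B: "B \<in> P"
  shows "stat \<alpha> \<beta> (attach P B) = stat \<alpha> \<beta> P + weight \<alpha> \<beta> (arcs P) (Min B)"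
proof -
  have arcs: "arcs (attach P B) = insert (1, Suc (Min B)) (shift_arcs (arcs P))"
    using B set_partitionsD(4-6)[OF P B] by (rule arcs_attach)
  have "card (crossings (arcs (attach P B))) =
      card (crossings (arcs P)) + card (covering (arcs P) (Min B))"
    unfolding arcs using finite_arcs[OF P] arcs_pos[OF P] by (intro card_crossings_insert) auto
  moreover have "card (nestings (arcs (attach P B))) =
      card (nestings (arcs P)) + card (preceding (arcs P) (Min B))"
    unfolding arcs using finite_arcs[OF P] arcs_pos[OF P] by (intro card_nestings_insert) auto
  ultimately show ?thesis
    by (simp add: stat_altdef weight_def nat_multiple_add add_ac)
qed

section \<open>Statistics on the levels of the tree\<close>

text \<open>Distinct blocks have distinct minima, so the blocks may be reindexed by the entries of a
  strictly increasing list.\<close>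

lemma sum_over_minima:
  assumes P: "P \<in> set_partitions n"
  shows "(\<Sum>B\<in>P. f (filter (\<lambda>y. y < Min B) (minima P)) (Min B) (filter (\<lambda>y. Min B < y) (minima P)))
    = split_sum f (minima P)"
  by (simp add: split_sum_sorted[OF sorted_minima] set_minima[OF P] sum.reindex[OF inj_on_Min[OF P]])

text \<open>Makes the rules for finite sums available; for infinite \<open>T\<close> both sides are
  the empty multiset.\<close>

lemma stat_mset_eq_sum: "stat_mset \<alpha> \<beta> T = (\<Sum>t\<in>T. {#stat \<alpha> \<beta> t#})"
  by (induction T rule: infinite_finite_induct) (simp_all add: stat_mset_def)

lemma stat_mset_tree_level_blocks_Suc:
  assumes P: "P \<in> set_partitions n"
  shows "stat_mset \<alpha> \<beta> (tree_level_blocks P (Suc l) m) =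
    (\<Sum>B\<in>insert {} P. stat_mset \<alpha> \<beta> (tree_level_blocks (attach P B) l m))"
  unfolding tree_level_blocks_Suc[OF P] stat_mset_eq_sum
proof (rule sum.UNION_disjoint)
  show "finite (insert {} P)" using set_partitionsD(1)[OF P] by simp
  show "\<forall>B\<in>insert {} P. finite (tree_level_blocks (attach P B) l m)"
    using attach_in_set_partitions[OF P] finite_tree_level_blocks by blast
  \<comment> \<open>A common descendant has only one ancestor \<open>l\<close> levels above it, so
    \<open>attach P B = attach P C\<close>, and \<open>attach P\<close> is injective.\<close>
  have "B = C" if "B \<in> insert {} P" "C \<in> insert {} P"
      "Q \<in> tree_level_blocks (attach P B) l m" "Q \<in> tree_level_blocks (attach P C) l m" for B C Q
    using that child_rel_ancestor_unique[of "attach P B" Q l "attach P C"]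
      inj_onD[OF inj_attach[OF P] _ that(1,2)]
    by (simp add: tree_level_blocks_def tree_level_def)
  then show "\<forall>B\<in>insert {} P. \<forall>C\<in>insert {} P. B \<noteq> C \<longrightarrow>
      tree_level_blocks (attach P B) l m \<inter> tree_level_blocks (attach P C) l m = {}"
    by (metis disjoint_iff)
qed

text \<open>Links the tree to the recursion on sequences: the singleton child gives the first
  summand of \<open>descend\<close>, the other children give the \<open>split_sum\<close>.\<close>

lemma stat_mset_tree_level_blocks:
  assumes "P \<in> set_partitions n"
  shows "stat_mset \<alpha> \<beta> (tree_level_blocks P l m) =
    image_mset ((+) (stat \<alpha> \<beta> P)) (descend \<alpha> \<beta> l m (weights \<alpha> \<beta> P))"
  using assms
proof (induction l arbitrary: P n)
  case 0
  have "tree_level_blocks P 0 m = (if card P = m then {P} else {})"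
    by (auto simp: tree_level_blocks_def tree_level_def)
  then show ?case using 0 by (simp add: stat_mset_def weights_def length_minima)
next
  case (Suc l)
  note P = Suc.prems
  define w where "w = weight \<alpha> \<beta> (arcs P)"
  define f where "f = (\<lambda>p x q. image_mset ((+) x)
      (descend \<alpha> \<beta> l m (0 # map ((+) \<alpha>) p @ map ((+) \<beta>) q)))"
  have level: "stat_mset \<alpha> \<beta> (tree_level_blocks (attach P B) l m) =
      image_mset ((+) (stat \<alpha> \<beta> (attach P B))) (descend \<alpha> \<beta> l m (weights \<alpha> \<beta> (attach P B)))"
    if "B \<in> insert {} P" for B
    using Suc.IH attach_in_set_partitions[OF P that] by blast
  \<comment> \<open>The increment \<open>w (Min B)\<close> of the statistic becomes the translation
    inside \<open>f\<close>, so the statistic of \<open>P\<close> can be taken out of the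
    sum.\<close>
  have "stat_mset \<alpha> \<beta> (tree_level_blocks (attach P B) l m) =
      image_mset ((+) (stat \<alpha> \<beta> P)) (f (map w (filter (\<lambda>y. y < Min B) (minima P))) (w (Min B))
        (map w (filter (\<lambda>y. Min B < y) (minima P))))" if "B \<in> P" for B
    using level[of B] that
    by (simp add: stat_attach[OF P that] weights_attach[OF P that] f_def w_def
        image_mset_add_add o_def del: image_mset.compositionality)
  then have "(\<Sum>B\<in>P. stat_mset \<alpha> \<beta> (tree_level_blocks (attach P B) l m)) =
      split_sum (\<lambda>p x q. image_mset ((+) (stat \<alpha> \<beta> P)) (f (map w p) (w x) (map w q))) (minima P)"
    by (simp add: sum_over_minima[OF P, symmetric])
  also have "\<dots> = image_mset ((+) (stat \<alpha> \<beta> P)) (split_sum f (weights \<alpha> \<beta> P))"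
    by (simp add: image_mset_split_sum split_sum_map weights_def w_def)
  finally have "stat_mset \<alpha> \<beta> (tree_level_blocks P (Suc l) m) =
      image_mset ((+) (stat \<alpha> \<beta> P)) (descend \<alpha> \<beta> l m (0 # weights \<alpha> \<beta> P)) +
      image_mset ((+) (stat \<alpha> \<beta> P)) (split_sum f (weights \<alpha> \<beta> P))"
    using set_partitionsD(1,2)[OF P] level[of "{}"]
    by (simp add: stat_mset_tree_level_blocks_Suc[OF P] stat_attach_empty[OF P] weights_attach_empty[OF P])
  then show ?case by (simp add: f_def)
qed

lemma stat_mset_tree_level_0: "stat_mset \<alpha> \<beta> (tree_level P 0) = {#stat \<alpha> \<beta> P#}"
proof -
  have "tree_level P 0 = {P}" by (auto simp: tree_level_def)
  then show ?thesis by (simp add: stat_mset_def)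
qed

lemma stat_mset_tree_level_1:
  assumes P: "P \<in> set_partitions n"
  shows "stat_mset \<alpha> \<beta> (tree_level P 1) =
    add_mset (stat \<alpha> \<beta> P) (image_mset ((+) (stat \<alpha> \<beta> P)) (mset (weights \<alpha> \<beta> P)))"
proof -
  have "tree_level P 1 = attach P ` insert {} P"
    using child_rel_iff[OF P] by (auto simp: tree_level_def)
  then have "stat_mset \<alpha> \<beta> (tree_level P 1) = (\<Sum>B\<in>insert {} P. {#stat \<alpha> \<beta> (attach P B)#})"
    by (simp add: stat_mset_eq_sum sum.reindex[OF inj_attach[OF P]] del: image_insert)
  also have "\<dots> = {#stat \<alpha> \<beta> P#} + (\<Sum>B\<in>P. {#stat \<alpha> \<beta> P + weight \<alpha> \<beta> (arcs P) (Min B)#})"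
    using set_partitionsD(1,2)[OF P] by (simp add: stat_attach_empty[OF P] stat_attach[OF P])
  also have "(\<Sum>B\<in>P. {#stat \<alpha> \<beta> P + weight \<alpha> \<beta> (arcs P) (Min B)#}) =
      image_mset ((+) (stat \<alpha> \<beta> P)) (image_mset (weight \<alpha> \<beta> (arcs P)) (mset (minima P)))"
    using sum_over_minima[OF P, of "\<lambda>p x q. {#stat \<alpha> \<beta> P + weight \<alpha> \<beta> (arcs P) x#}"]
    by (simp add: split_sum_singleton[symmetric] image_mset_split_sum)
  finally show ?thesis by (simp add: weights_def)
qed

text \<open>Level 0 is the statistic of the root. It recurs on level 1 through the singleton child
  and cancels; translation by it is injective on multisets. The separate parameters \<gamma>,
  \<delta> serve (a) and (b) at once.\<close>

lemma levels_0_1_determine_weights: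
  assumes "P \<in> set_partitions n" "Q \<in> set_partitions k"
    and "\<forall>l\<in>{0, 1}. stat_mset \<alpha> \<beta> (tree_level P l) = stat_mset \<gamma> \<delta> (tree_level Q l)"
  shows "stat \<alpha> \<beta> P = stat \<gamma> \<delta> Q" "mset (weights \<alpha> \<beta> P) = mset (weights \<gamma> \<delta> Q)"
proof -
  show eq: "stat \<alpha> \<beta> P = stat \<gamma> \<delta> Q"
    using assms(3) by (simp add: stat_mset_tree_level_0)
  have "stat_mset \<alpha> \<beta> (tree_level P 1) = stat_mset \<gamma> \<delta> (tree_level Q 1)"
    using assms(3) by blast
  then have "image_mset ((+) (stat \<alpha> \<beta> P)) (mset (weights \<alpha> \<beta> P)) =
      image_mset ((+) (stat \<alpha> \<beta> P)) (mset (weights \<gamma> \<delta> Q))"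
    unfolding stat_mset_tree_level_1[OF assms(1)] stat_mset_tree_level_1[OF assms(2)] eq by simp
  then show "mset (weights \<alpha> \<beta> P) = mset (weights \<gamma> \<delta> Q)"
    by (rule injD[OF multiset.inj_map, rotated]) simp
qed

theorem theorem1p1:
  fixes \<alpha> \<beta> :: "'g :: ab_group_add"
    and lam \<pi> :: "nat set set"
    and n k :: nat
  assumes "lam \<in> set_partitions n" and "lam \<noteq> {}"
    and "\<pi> \<in> set_partitions k" and "\<pi> \<noteq> {}"
  shows "((\<forall>l\<in>{0, 1}. stat_mset \<alpha> \<beta> (tree_level lam l) = stat_mset \<alpha> \<beta> (tree_level \<pi> l)) \<longrightarrow>
          (\<forall>l m. stat_mset \<alpha> \<beta> (tree_level_blocks lam l m) =
                 stat_mset \<alpha> \<beta> (tree_level_blocks \<pi> l m))) \<and>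
         ((\<forall>l\<in>{0, 1}. stat_mset \<alpha> \<beta> (tree_level lam l) = stat_mset \<beta> \<alpha> (tree_level \<pi> l)) \<longrightarrow>
          (\<forall>l m. stat_mset \<alpha> \<beta> (tree_level_blocks lam l m) =
                 stat_mset \<beta> \<alpha> (tree_level_blocks \<pi> l m)))"
proof (intro conjI impI allI)
  fix l m
  assume "\<forall>l\<in>{0, 1}. stat_mset \<alpha> \<beta> (tree_level lam l) = stat_mset \<alpha> \<beta> (tree_level \<pi> l)"
  note eq = levels_0_1_determine_weights[OF assms(1,3) this]
  show "stat_mset \<alpha> \<beta> (tree_level_blocks lam l m) = stat_mset \<alpha> \<beta> (tree_level_blocks \<pi> l m)"
    unfolding stat_mset_tree_level_blocks[OF assms(1)] stat_mset_tree_level_blocks[OF assms(3)]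
      eq(1) descend_mset_cong[OF eq(2)] ..
next
  fix l m
  assume "\<forall>l\<in>{0, 1}. stat_mset \<alpha> \<beta> (tree_level lam l) = stat_mset \<beta> \<alpha> (tree_level \<pi> l)"
  note eq = levels_0_1_determine_weights[OF assms(1,3) this]
  \<comment> \<open>Compared with (a), the parameters of \<open>descend\<close> must also be
    interchanged, by \<open>descend_commute\<close>.\<close>
  show "stat_mset \<alpha> \<beta> (tree_level_blocks lam l m) = stat_mset \<beta> \<alpha> (tree_level_blocks \<pi> l m)"
    unfolding stat_mset_tree_level_blocks[OF assms(1)] stat_mset_tree_level_blocks[OF assms(3)]
      eq(1) descend_mset_cong[OF eq(2)] descend_commute[of \<alpha> \<beta>] ..
qed

end
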